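(* Let $f:\{0,1\}^n\to\mathbb{R}$ be a submodular function with $f(\mathbf 0)=0$. Then both the extended envelope epigraph $EE_f$ and the set $Q_f:=\mathrm{conv}(\{(x,t)\in\{0,1\}^n\times\mathbb{R}: f(x)\le t\})$ are $\mathrm{hypo}(f)$-free sets.
   Context: $f$ is submodular if $f(x)+f(y)\ge f(x\vee y)+f(x\wedge y)$ for all $x,y\in\{0,1\}^n$ (componentwise max and min). The product $sx$ of two vectors is the inner product. The extended polymatroid is $EPM_f:=\{s\in\mathbb{R}^n: sx\le f(x)\ \forall x\in\{0,1\}^n\}$, with vertex set $\mathrm{ext}(EPM_f)$. The extended envelope epigraph is $EE_f:=\{(x,t)\in\mathbb{R}^n\times\mathbb{R}: sx\le t\ \forall s\in\mathrm{ext}(EPM_f)\}$. The hypograph is $\mathrm{hypo}(f):=\{(x,t)\in\{0,1\}^n\times\mathbb{R}: f(x)\ge t\}$. A closed convex set $\mathcal{C}$ is $\mathcal{S}$-free if $\mathrm{int}(\mathcal{C})\cap\mathcal{S}=\varnothing$. *)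

theory Defs
  imports "HOL-Analysis.Analysis"
begin

text \<open>
  Functions on \<open>{0,1}\<^sup>n\<close> are rendered as functions on \<open>\<real>\<^sup>n\<close>
  of which every notion below only inspects the values on \<open>cube01\<close>.
\<close>

definition cube01 :: "(real ^ 'n) set" where
  "cube01 = {x. \<forall>i. x $ i \<in> {0, 1}}"

text \<open>On vectors, \<open>sup\<close> and \<open>inf\<close> are the componentwise maximum and minimum.\<close>

definition submodular :: "(real ^ 'n \<Rightarrow> real) \<Rightarrow> bool" where
  "submodular f \<longleftrightarrow> (\<forall>x\<in>cube01. \<forall>y\<in>cube01. f x + f y \<ge> f (sup x y) + f (inf x y))"

definition EPM :: "(real ^ 'n \<Rightarrow> real) \<Rightarrow> (real ^ 'n) set" where
  "EPM f = {s. \<forall>x\<in>cube01. s \<bullet> x \<le> f x}"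

definition ext :: "'a::real_vector set \<Rightarrow> 'a set" where
  "ext S = {v. v extreme_point_of S}"

definition EE :: "(real ^ 'n \<Rightarrow> real) \<Rightarrow> ((real ^ 'n) \<times> real) set" where
  "EE f = {(x, t). \<forall>s\<in>ext (EPM f). s \<bullet> x \<le> t}"

definition hypo :: "(real ^ 'n \<Rightarrow> real) \<Rightarrow> ((real ^ 'n) \<times> real) set" where
  "hypo f = {(x, t). x \<in> cube01 \<and> f x \<ge> t}"

definition Q :: "(real ^ 'n \<Rightarrow> real) \<Rightarrow> ((real ^ 'n) \<times> real) set" where
  "Q f = convex hull {(x, t). x \<in> cube01 \<and> f x \<le> t}"

definition free_set :: "'a::euclidean_space set \<Rightarrow> 'a set \<Rightarrow> bool" where
  "free_set S C \<longleftrightarrow> closed C \<and> convex C \<and> interior C \<inter> S = {}"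

end

theory Submission
  imports Defs
begin

text \<open>
  The greedy vectors of Edmonds carry the result.  Identify a 0/1 vector with a subset of the index
  set, and add the indices one at a time, giving each new index the marginal value of \<open>f\<close>
  as its weight.  Submodularity makes marginal values decrease, so the weight of a
  set never exceeds its value: the resulting vector lies in \<open>EPM f\<close>.  The weight and the value
  agree on every set of the chain that was built up, and these equalities determine the vector.
  Hence it is a vertex of \<open>EPM f\<close>.  Since the chain can be led through any given set,
  every point \<open>x\<close> of the cube has a vertex \<open>s\<close> with \<open>s \<bullet> x = f x\<close>
  (\<open>tight_vertex\<close>).

  An interior point \<open>(x, t)\<close> of \<open>EE f\<close> can be moved down a little inside \<open>EE f\<close>,
  so \<open>s \<bullet> x < t\<close> for every vertex \<open>s\<close>.  If \<open>x\<close> lies in the cube, the tight vertex gives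
  \<open>f x < t\<close>, and \<open>(x, t)\<close> is not in the hypograph.  Moreover \<open>Q f \<subseteq> EE f\<close>, because
  vertices of \<open>EPM f\<close> minorise \<open>f\<close> on the cube and \<open>EE f\<close> is convex; so \<open>Q f\<close> inherits the
  disjointness, and it is closed as the sum of a polytope and a vertical ray.
\<close>

section \<open>Greedy vectors of a submodular set function\<close>

text \<open>
  The weight function \<open>s\<close> is a vertex of the extended polymatroid of the restriction of \<open>F\<close> to the
  subsets of \<open>A\<close>, with \<open>A\<close> itself a tight set.  The vertex property is expressed by the last clause:
  the tight sets determine \<open>s\<close> on \<open>A\<close>.
\<close>

definition tight_weight :: "('a set \<Rightarrow> real) \<Rightarrow> 'a set \<Rightarrow> ('a \<Rightarrow> real) \<Rightarrow> bool" where
  "tight_weight F A s \<longleftrightarrow>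
     (\<forall>X\<subseteq>A. sum s X \<le> F X) \<and> sum s A = F A \<and>
     (\<forall>a. (\<forall>X\<subseteq>A. sum s X = F X \<longrightarrow> sum a X = F X) \<longrightarrow> (\<forall>i\<in>A. a i = s i))"

text \<open>
  For \<open>Y \<subseteq> A\<close>, submodularity bounds the marginal value of \<open>e\<close> over \<open>A\<close> by the
  one over \<open>Y\<close>, which gives the inequality for the sets containing \<open>e\<close>.  The tight sets \<open>A\<close> and
  \<open>insert e A\<close> together determine the new weight.
\<close>

lemma tight_weight_insert:
  fixes F :: "'a set \<Rightarrow> real"
  assumes sub: "\<And>X Y. F (X \<union> Y) + F (X \<inter> Y) \<le> F X + F Y"
    and tw: "tight_weight F A s" and fin: "finite A" and e: "e \<notin> A"
  shows "tight_weight F (insert e A) (s(e := F (insert e A) - F A))"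
proof -
  define s' where "s' = s(e := F (insert e A) - F A)"
  have le: "sum s X \<le> F X" if "X \<subseteq> A" for X
    using tw that by (auto simp: tight_weight_def)
  have sA: "sum s A = F A"
    using tw by (simp add: tight_weight_def)
  have det: "a i = s i" if "\<forall>X\<subseteq>A. sum s X = F X \<longrightarrow> sum a X = F X" "i \<in> A" for a i
    using tw that by (auto simp: tight_weight_def)
  have s'_old: "sum s' X = sum s X" if "X \<subseteq> A" for X
    unfolding s'_def using that e by (intro sum.cong) auto
  have s'_new: "sum s' (insert e X) = F (insert e A) - F A + sum s X" if "X \<subseteq> A" for X
  proof -
    have "finite X" "e \<notin> X"
      using that fin e by (auto intro: finite_subset)
    then show ?thesis
      using s'_old[OF that] by (simp add: s'_def)
  qed
  have le': "sum s' X \<le> F X" if X: "X \<subseteq> insert e A" for X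
  proof (cases "e \<in> X")
    case False
    then have "X \<subseteq> A"
      using X by blast
    then show ?thesis
      using s'_old le by simp
  next
    case True
    define Y where "Y = X - {e}"
    have Y: "Y \<subseteq> A" "X = insert e Y"
      using X True by (auto simp: Y_def)
    have "X \<union> A = insert e A" "X \<inter> A = Y"
      using Y e by auto
    then have "F (insert e A) + F Y \<le> F X + F A"
      using sub[of X A] by simp
    then show ?thesis
      using s'_new[OF Y(1)] le[OF Y(1)] Y(2) by simp
  qed
  have tight': "sum s' (insert e A) = F (insert e A)"
    using s'_new[of A] sA by simp
  have "a i = s' i"
    if a: "\<forall>X\<subseteq>insert e A. sum s' X = F X \<longrightarrow> sum a X = F X" and i: "i \<in> insert e A" for a i
  proof -
    have "\<forall>X\<subseteq>A. sum s X = F X \<longrightarrow> sum a X = F X"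
      using a s'_old by (metis subset_insertI2)
    then have old: "a j = s j" if "j \<in> A" for j
      using det that by blast
    have "sum a (insert e A) = F (insert e A)" "sum a A = F A"
      using a tight' s'_old[of A] sA by auto
    then have "a e = s' e"
      using fin e by (simp add: s'_def)
    then show ?thesis
      using old i e by (auto simp: s'_def)
  qed
  then show ?thesis
    using le' tight' unfolding s'_def[symmetric] tight_weight_def by blast
qed

text \<open>
  Since the weights on \<open>A\<close> are kept, every tight subset of \<open>A\<close> stays tight; this is what allows the
  chain to be led through a prescribed set.
\<close>

lemma tight_weight_extend:
  fixes F :: "'a set \<Rightarrow> real"
  assumes sub: "\<And>X Y. F (X \<union> Y) + F (X \<inter> Y) \<le> F X + F Y"
    and "tight_weight F A s" "finite A" "finite D" "A \<inter> D = {}"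
  shows "\<exists>s'. tight_weight F (A \<union> D) s' \<and> (\<forall>i\<in>A. s' i = s i)"
  using assms(4,5)
proof (induction D rule: finite_induct)
  case empty
  then show ?case
    using assms(2) by auto
next
  case (insert e D)
  then obtain s' where s': "tight_weight F (A \<union> D) s'" "\<forall>i\<in>A. s' i = s i"
    by auto
  have "e \<notin> A \<union> D" "finite (A \<union> D)"
    using insert assms(3) by auto
  then have "tight_weight F (A \<union> insert e D) (s'(e := F (insert e (A \<union> D)) - F (A \<union> D)))"
    using tight_weight_insert[OF sub s'(1)] by simp
  moreover have "\<forall>i\<in>A. (s'(e := F (insert e (A \<union> D)) - F (A \<union> D))) i = s i"
    using s'(2) \<open>e \<notin> A \<union> D\<close> by auto
  ultimately show ?case
    by blast
qed

lemma tight_weight_through: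
  fixes F :: "'a::finite set \<Rightarrow> real"
  assumes sub: "\<And>X Y. F (X \<union> Y) + F (X \<inter> Y) \<le> F X + F Y" and F0: "F {} = 0"
  obtains s where "tight_weight F UNIV s" "sum s A = F A"
proof -
  have "tight_weight F {} (\<lambda>_. 0)"
    using F0 by (simp add: tight_weight_def)
  from tight_weight_extend[OF sub this, of A]
  obtain s0 where s0: "tight_weight F A s0"
    by auto
  from tight_weight_extend[OF sub this, of "- A"]
  obtain s where s: "tight_weight F UNIV s" "\<forall>i\<in>A. s i = s0 i"
    by auto
  have "sum s A = sum s0 A"
    using s(2) by (intro sum.cong) auto
  also have "\<dots> = F A"
    using s0 by (simp add: tight_weight_def)
  finally show thesis
    using s(1) that by blast
qed

section \<open>Tight vertices of the extended polymatroid\<close>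

definition char_vec :: "'n set \<Rightarrow> real ^ 'n" where
  "char_vec A = (\<chi> i. if i \<in> A then 1 else 0)"

lemma cube01_eq_range_char_vec: "(cube01 :: (real ^ 'n) set) = range char_vec"
proof
  show "(cube01 :: (real ^ 'n) set) \<subseteq> range char_vec"
  proof
    fix x :: "real ^ 'n"
    assume "x \<in> cube01"
    then have "x = char_vec {i. x $ i = 1}"
      by (auto simp: cube01_def char_vec_def vec_eq_iff)
    then show "x \<in> range char_vec"
      by blast
  qed
qed (auto simp: cube01_def char_vec_def)

lemma inner_char_vec: "s \<bullet> char_vec A = sum (($) s) A"
proof -
  have "s \<bullet> char_vec A = (\<Sum>i\<in>UNIV. if i \<in> A then s $ i else 0)"
    unfolding inner_vec_def char_vec_def by (intro sum.cong) auto
  also have "\<dots> = sum (($) s) A"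
    by (simp add: sum.If_cases)
  finally show ?thesis .
qed

lemma submodular_char_vec:
  assumes "submodular f"
  shows "f (char_vec (X \<union> Y)) + f (char_vec (X \<inter> Y)) \<le> f (char_vec X) + f (char_vec Y)"
proof -
  have "sup (char_vec X) (char_vec Y) = char_vec (X \<union> Y)"
    "inf (char_vec X) (char_vec Y) = char_vec (X \<inter> Y)"
    by (auto simp: vec_eq_iff char_vec_def sup_vec_def inf_vec_def sup_real_def inf_real_def)
  moreover have "char_vec X \<in> cube01" "char_vec Y \<in> cube01"
    by (auto simp: cube01_eq_range_char_vec)
  ultimately show ?thesis
    using assms unfolding submodular_def by metis
qed

lemma mem_EPM_iff: "s \<in> EPM f \<longleftrightarrow> (\<forall>X. sum (($) s) X \<le> f (char_vec X))"
  by (simp add: EPM_def cube01_eq_range_char_vec inner_char_vec)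

text \<open>
  If \<open>s\<close> lies strictly between two points of the polyhedron, an inequality that is tight
  at \<open>s\<close> is tight at both of them; as the tight inequalities determine \<open>s\<close>, the two points coincide.
\<close>

lemma tight_weight_extreme_point:
  fixes s :: "real ^ 'n"
  assumes tw: "tight_weight (\<lambda>X. f (char_vec X)) UNIV (($) s)"
  shows "s extreme_point_of EPM f"
  unfolding extreme_point_of_def
proof (intro conjI ballI notI)
  show "s \<in> EPM f"
    using tw by (simp add: mem_EPM_iff tight_weight_def)
next
  fix a b
  assume a: "a \<in> EPM f" and b: "b \<in> EPM f" and seg: "s \<in> open_segment a b"
  then obtain u where u: "a \<noteq> b" "0 < u" "u < 1" "s = (1 - u) *\<^sub>R a + u *\<^sub>R b"
    by (auto simp: in_segment)
  have ab: "sum (($) a) X = f (char_vec X)" "sum (($) b) X = f (char_vec X)"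
    if X: "sum (($) s) X = f (char_vec X)" for X
  proof -
    let ?v = "f (char_vec X)"
    have le: "sum (($) a) X \<le> ?v" "sum (($) b) X \<le> ?v"
      using a b by (auto simp: mem_EPM_iff)
    have "s \<bullet> char_vec X = (1 - u) * (a \<bullet> char_vec X) + u * (b \<bullet> char_vec X)"
      by (simp add: u(4) inner_add_left)
    then have "(1 - u) * (?v - sum (($) a) X) + u * (?v - sum (($) b) X) = 0"
      using X by (simp add: inner_char_vec algebra_simps)
    moreover have "0 \<le> (1 - u) * (?v - sum (($) a) X)" "0 \<le> u * (?v - sum (($) b) X)"
      using le u by auto
    ultimately have "(1 - u) * (?v - sum (($) a) X) = 0" "u * (?v - sum (($) b) X) = 0"
      by linarith+
    then show "sum (($) a) X = ?v" "sum (($) b) X = ?v"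
      using u by auto
  qed
  have "a = s" "b = s"
    using tw ab unfolding tight_weight_def vec_eq_iff by blast+
  then show False
    using u(1) by simp
qed

lemma tight_vertex:
  fixes f :: "real ^ 'n \<Rightarrow> real"
  assumes "submodular f" "f 0 = 0" "x \<in> cube01"
  obtains s where "s \<in> ext (EPM f)" "s \<bullet> x = f x"
proof -
  obtain A where A: "x = char_vec A"
    using assms(3) by (auto simp: cube01_eq_range_char_vec)
  have "char_vec {} = (0 :: real ^ 'n)"
    by (simp add: char_vec_def vec_eq_iff)
  then obtain w where w: "tight_weight (\<lambda>X. f (char_vec X)) UNIV w" "sum w A = f (char_vec A)"
    using tight_weight_through[of "\<lambda>X. f (char_vec X)" A] submodular_char_vec[OF assms(1)] assms(2)
    by auto
  have "($) (\<chi> i. w i) = w"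
    by (simp add: fun_eq_iff)
  then show thesis
    using w A that[of "\<chi> i. w i"] tight_weight_extreme_point[of f "\<chi> i. w i"]
    by (simp add: ext_def inner_char_vec)
qed

section \<open>The two epigraphs\<close>

lemma EE_eq_Inter_halfspaces: "EE f = (\<Inter>s\<in>ext (EPM f). {p. (s, -1) \<bullet> p \<le> 0})"
  by (auto simp: EE_def)

lemma closed_EE: "closed (EE f)"
  unfolding EE_eq_Inter_halfspaces by (intro closed_INT ballI closed_halfspace_le)

lemma convex_EE: "convex (EE f)"
  unfolding EE_eq_Inter_halfspaces by (intro convex_INT convex_halfspace_le)

lemma interior_EE_disjoint_hypo:
  assumes "submodular f" "f 0 = 0"
  shows "interior (EE f) \<inter> hypo f = {}"
proof -
  have False if int: "(x, t) \<in> interior (EE f)" and x: "x \<in> cube01" and t: "t \<le> f x" for x t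
  proof -
    obtain e where e: "e > 0" "ball (x, t) e \<subseteq> EE f"
      using int by (auto simp: mem_interior)
    have "(x, t - e / 2) \<in> ball (x, t) e"
      using e(1) by (simp add: dist_Pair_Pair dist_real_def)
    then have "(x, t - e / 2) \<in> EE f"
      using e(2) by blast
    moreover obtain s where "s \<in> ext (EPM f)" "s \<bullet> x = f x"
      using tight_vertex[OF assms x] .
    ultimately have "f x \<le> t - e / 2"
      by (auto simp: EE_def)
    then show False
      using t e(1) by linarith
  qed
  then show ?thesis
    by (auto simp: hypo_def)
qed

lemma Q_subset_EE: "Q f \<subseteq> EE f"
  unfolding Q_def
proof (rule hull_minimal)
  show "{(x, t). x \<in> cube01 \<and> f x \<le> t} \<subseteq> EE f"
    by (fastforce simp: EE_def ext_def extreme_point_of_def EPM_def)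
qed (rule convex_EE)

text \<open>
  The generating set is the finite graph of \<open>f\<close> on the cube plus a vertical ray, and convex hulls
  commute with Minkowski sums; so \<open>Q f\<close> is a compact set plus a closed one.
\<close>

lemma closed_Q:
  fixes f :: "real ^ 'n \<Rightarrow> real"
  shows "closed (Q f)"
proof -
  let ?G = "(\<lambda>x. (x, f x)) ` cube01"
  let ?R = "{0 :: real ^ 'n} \<times> {0 :: real ..}"
  have "{(x, t). x \<in> cube01 \<and> f x \<le> t} = ?G + ?R"
  proof (intro set_eqI iffI)
    fix p
    assume "p \<in> {(x, t). x \<in> cube01 \<and> f x \<le> t}"
    then obtain x t where "p = (x, f x) + (0, t - f x)" "x \<in> cube01" "f x \<le> t"
      by auto
    moreover from this have "(x, f x) \<in> ?G" "(0, t - f x) \<in> ?R"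
      by auto
    ultimately show "p \<in> ?G + ?R"
      by (simp only: set_plus_intro)
  qed (auto simp: set_plus_def)
  then have "Q f = convex hull ?G + convex hull ?R"
    unfolding Q_def by (simp add: convex_hull_set_plus)
  also have "convex hull ?R = ?R"
    by (intro convex_hull_eq[THEN iffD2] convex_Times) auto
  finally have Q: "Q f = (\<Union>p\<in>convex hull ?G. \<Union>q\<in>?R. {p + q})"
    by (simp only: set_plus_def) blast
  have "finite (cube01 :: (real ^ 'n) set)"
    by (simp add: cube01_eq_range_char_vec)
  then have "compact (convex hull ?G)"
    by (intro finite_imp_compact_convex_hull finite_imageI)
  then show ?thesis
    unfolding Q by (intro compact_closed_sums closed_Times) auto
qed

theorem proposition4:
  fixes f :: "real ^ 'n \<Rightarrow> real"
  assumes "submodular f" and "f 0 = 0"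
  shows "free_set (hypo f) (EE f) \<and> free_set (hypo f) (Q f)"
proof -
  have "interior (Q f) \<subseteq> interior (EE f)"
    by (intro interior_mono Q_subset_EE)
  then show ?thesis
    using interior_EE_disjoint_hypo[OF assms] closed_EE convex_EE closed_Q
    by (auto simp: free_set_def Q_def convex_convex_hull)
qed

end
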